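(* Let $2<r<\infty$, let $\nu$ be an admissible function for the space $G(\nu;r)$ (see context), and let $\{\xi(i)\}_{i\ge1}$ be a sequence of centered martingale differences relative to a filtration $\{F(i)\}_{i\ge0}$, with $\sup_i\|\xi(i)\|_{G(\nu;r)}<\infty$. Put $$U(x)=\sup_{n\ge1}\mathbf{P}\left(\left|n^{-1/2}\sum_{k=1}^n\xi(k)\right|\ge x\right).$$ Then there is a finite constant $C$ depending only on $r$ and the law of the sequence $\{\xi(i)\}$ such that for all $x>0$ $$U(x)\le C\,T^{(\nu)}(x),\qquad\text{where } T^{(\nu)}(x)=\inf_{p\in(1,r)}\left[\nu(p)^p/x^p\right].$$
   Context: Notation: $|\xi|_p=[\mathbf{E}|\xi|^p]^{1/p}$. Let $2<r<\infty$ and let $\nu$ be a continuous positive function on $[1,r)$ with $\inf_{p\in(2,r)}\nu(p)>0$, and $\nu(p)=\infty$ for $p>r$ (such $\nu$ is called admissible). The space $G(\nu)=G(\nu;r)$ consists of all random variables on the probability space $(\Omega,\mathcal{A},\mathbf{P})$ with finite norm $\|\xi\|_{G(\nu;r)}=\sup_{p\in(2,r)}|\xi|_p/\nu(p)$. Centered martingale differences: $F(0)=\{\emptyset,\Omega\}$, $F(i)\subset F(i+1)\subset\mathcal{A}$ are sigma-algebras, $\xi(i)$ is $F(i)$-measurable, $\mathbf{E}\xi(i)=0$, and $\mathbf{E}[\xi(k)\mid F(k-1)]=0$ for $k=1,2,\dots$.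
   Formalization: The constant C is allowed to depend on ν as well as on r and the law of the sequence; independence of ν is false, since replacing ν by εν keeps the hypotheses but sends T^(ν)(x) to 0. *)

theory Defs
  imports "HOL-Probability.Probability"
begin

text \<open>Real powers of extended nonnegative numbers; only positive exponents \<open>q\<close> are meant.\<close>

definition epowr :: "ennreal \<Rightarrow> real \<Rightarrow> ennreal" where
  "epowr a q = (if a = \<top> then \<top> else ennreal (enn2real a powr q))"

text \<open>
  The moment norm \<open>|\<xi>|\<^sub>p = (E |\<xi>|^p)^(1/p)\<close>. It is taken in \<open>[0,\<infinity>]\<close>, so that a random variable
  without \<open>p\<close>-th moment has norm \<open>\<infinity>\<close>.
\<close>

definition moment_norm :: "'a measure \<Rightarrow> real \<Rightarrow> ('a \<Rightarrow> real) \<Rightarrow> ennreal" where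
  "moment_norm M p \<xi> = epowr (\<integral>\<^sup>+ \<omega>. ennreal (\<bar>\<xi> \<omega>\<bar> powr p) \<partial>M) (1 / p)"

text \<open>No condition is imposed at \<open>p = r\<close>, nor outside \<open>[1, \<infinity>)\<close>.\<close>

definition admissible :: "real \<Rightarrow> (real \<Rightarrow> ennreal) \<Rightarrow> bool" where
  "admissible r \<nu> \<longleftrightarrow>
     continuous_on {1..<r} \<nu> \<and>
     (\<forall>p\<in>{1..<r}. 0 < \<nu> p \<and> \<nu> p < \<top>) \<and>
     0 < (INF p\<in>{2<..<r}. \<nu> p) \<and>
     (\<forall>p>r. \<nu> p = \<top>)"

definition G_norm :: "'a measure \<Rightarrow> (real \<Rightarrow> ennreal) \<Rightarrow> real \<Rightarrow> ('a \<Rightarrow> real) \<Rightarrow> ennreal" where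
  "G_norm M \<nu> r \<xi> = (SUP p\<in>{2<..<r}. moment_norm M p \<xi> / \<nu> p)"

text \<open>
  The \<open>\<sigma>\<close>-algebras are indexed by \<open>i \<ge> 0\<close> and the differences by \<open>i \<ge> 1\<close>; the value \<open>\<xi> 0\<close> is
  irrelevant. Integrability is required explicitly because \<open>lebesgue_integral\<close> and
  \<open>real_cond_exp\<close> are total functions.
\<close>

definition centered_martingale_differences ::
    "'a measure \<Rightarrow> (nat \<Rightarrow> 'a measure) \<Rightarrow> (nat \<Rightarrow> 'a \<Rightarrow> real) \<Rightarrow> bool" where
  "centered_martingale_differences M F \<xi> \<longleftrightarrow>
     filtration (space M) F \<and>
     (\<forall>i. subalgebra M (F i)) \<and>
     sets (F 0) = {{}, space M} \<and>
     (\<forall>i\<ge>1. \<xi> i \<in> borel_measurable (F i)) \<and>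
     (\<forall>i\<ge>1. integrable M (\<xi> i)) \<and>
     (\<forall>i\<ge>1. (\<integral>\<omega>. \<xi> i \<omega> \<partial>M) = 0) \<and>
     (\<forall>k\<ge>1. AE \<omega> in M. real_cond_exp M (F (k - 1)) (\<xi> k) \<omega> = 0)"

definition seq_law :: "'a measure \<Rightarrow> (nat \<Rightarrow> 'a \<Rightarrow> real) \<Rightarrow> (nat \<Rightarrow> real) measure" where
  "seq_law M \<xi> = distr M (PiM {1..} (\<lambda>_. borel)) (\<lambda>\<omega>. \<lambda>i\<in>{1..}. \<xi> i \<omega>)"

definition U :: "'a measure \<Rightarrow> (nat \<Rightarrow> 'a \<Rightarrow> real) \<Rightarrow> real \<Rightarrow> ennreal" where
  "U M \<xi> x =
     (SUP n\<in>{1..}. emeasure M {\<omega> \<in> space M. \<bar>real n powr (- 1 / 2) * (\<Sum>k=1..n. \<xi> k \<omega>)\<bar> \<ge> x})"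

definition T :: "(real \<Rightarrow> ennreal) \<Rightarrow> real \<Rightarrow> real \<Rightarrow> ennreal" where
  "T \<nu> r x = (INF p\<in>{1<..<r}. epowr (\<nu> p) p / ennreal (x powr p))"

end

theory Submission
  imports Defs
begin

text \<open>
  The point is a moment inequality for martingales with a constant that stays bounded in \<open>p\<close>: if
  \<open>2 < p \<le> r\<close> and all martingale differences satisfy \<open>|\<xi>(i)|\<^sub>p \<le> b\<close>, then
  \<open>E |\<xi>(1) + \<dots> + \<xi>(n)|\<^sup>p \<le> (D n)\<^sup>p\<^sup>/\<^sup>2 b\<^sup>p\<close> with \<open>D\<close> depending on \<open>r\<close> only
  (\<open>martingale_moment_le\<close>). Instead of the Burkholder inequalities, a direct induction on \<open>n\<close> is used.
  The elementary estimate \<open>abs_add_powr_le\<close> expands \<open>|x + y|\<^sup>p\<close> to first order in \<open>y\<close> with remainder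
  \<open>K (|x|\<^sup>p\<^sup>-\<^sup>2 y\<^sup>2 + |y|\<^sup>p)\<close>. Taking \<open>x\<close> to be the sum of the first \<open>n\<close> differences and \<open>y\<close> the next
  one, the first-order term has expectation zero, and Hoelder's inequality turns the remainder into
  the recursion \<open>a \<mapsto> a + K (a\<^sup>1\<^sup>-\<^sup>2\<^sup>/\<^sup>p b\<^sup>2 + b\<^sup>p)\<close> for the \<open>p\<close>-th moments
  (\<open>moment_add_martingale_difference_le\<close>), whose solutions grow at most like \<open>n\<^sup>p\<^sup>/\<^sup>2\<close>
  (\<open>growth_recursion_le\<close>).

  If \<open>\<kappa>\<close> bounds the norms of the \<open>\<xi>(i)\<close> in \<open>G(\<nu>; r)\<close>, one may take \<open>b = \<kappa> \<nu>(p)\<close>, and Markov's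
  inequality gives \<open>U(x) \<le> D\<^sup>p\<^sup>/\<^sup>2 \<kappa>\<^sup>p \<nu>(p)\<^sup>p / x\<^sup>p\<close> for every \<open>p \<in> (2, r)\<close>, with a factor that is
  bounded because \<open>p < r\<close>. For \<open>p \<in> (1, 2]\<close> the norm does not involve \<open>\<nu>(p)\<close>, but \<open>\<nu>(p)\<^sup>p\<close> is at
  least some \<open>m > 0\<close> there, and \<open>U(x) \<le> const / x\<^sup>p\<close> follows from \<open>U(x) \<le> 1\<close> when \<open>x \<le> 1\<close> and from the
  bound for one fixed exponent \<open>s > 2\<close> when \<open>x > 1\<close>. The supremum of the norms is determined by the
  law of the sequence (\<open>G_norm_seq_law\<close>), hence so is the constant.
\<close>

section \<open>Second-order expansion of \<open>|x + y|\<close> to the power \<open>p\<close>\<close>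

text \<open>
  A crude constant that serves for all \<open>p \<in> [2, r]\<close> at once: it dominates the second-order Taylor
  coefficient \<open>p (p - 1) / 2 \<cdot> 2\<^sup>p\<^sup>-\<^sup>2\<close>, relevant for \<open>|y| < |x|\<close>, and \<open>2\<^sup>p + p\<close>, relevant for \<open>|x| \<le> |y|\<close>.
\<close>

definition expansion_const :: "real \<Rightarrow> real" where
  "expansion_const r = r\<^sup>2 * 2 powr r"

lemma expansion_const_ge_1: "2 \<le> r \<Longrightarrow> 1 \<le> expansion_const r"
proof -
  assume r: "2 \<le> r"
  have "1 * 1 \<le> r\<^sup>2 * 2 powr r"
    using r by (intro mult_mono ge_one_powr_ge_zero) (auto intro: power_increasing one_le_power)
  then show ?thesis by (simp add: expansion_const_def)
qed

text \<open>
  The restriction \<open>|y| < x\<close> keeps the whole segment from \<open>x\<close> to \<open>x + y\<close> inside \<open>(0, 2 x)\<close>, where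
  the power is smooth and its second derivative is at most \<open>p\<^sup>2 (2 x)\<^sup>p\<^sup>-\<^sup>2\<close>.
\<close>

lemma powr_taylor_le:
  fixes x y p :: real
  assumes p: "2 \<le> p" and x: "0 < x" and y: "\<bar>y\<bar> < x"
  shows "(x + y) powr p \<le> x powr p + p * x powr (p - 1) * y + p\<^sup>2 * 2 powr p * (x powr (p - 2) * y\<^sup>2)"
proof (cases "y = 0")
  case False
  let ?d = "\<lambda>m t. if m = 0 then t powr p else if m = (1::nat) then p * t powr (p - 1)
                    else p * (p - 1) * t powr (p - 2)"
  have "\<exists>t. (if x + y < x then x + y < t \<and> t < x else x < t \<and> t < x + y) \<and>
      (x + y) powr p = (\<Sum>m<2. ?d m x / fact m * (x + y - x) ^ m) + ?d 2 t / fact 2 * (x + y - x) ^ 2"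
  proof (rule Taylor[where a = "min x (x + y)" and b = "max x (x + y)"])
    show "\<forall>m t. m < 2 \<and> min x (x + y) \<le> t \<and> t \<le> max x (x + y) \<longrightarrow>
        DERIV (?d m) t :> ?d (Suc m) t"
    proof (intro allI impI)
      fix m :: nat and t :: real
      assume *: "m < 2 \<and> min x (x + y) \<le> t \<and> t \<le> max x (x + y)"
      then have t: "0 < t" using x y by (auto simp: min_def split: if_splits)
      from * have "m = 0 \<or> m = 1" by auto
      then show "DERIV (?d m) t :> ?d (Suc m) t"
        using t by (auto intro!: derivative_eq_intros simp: diff_diff_eq)
    qed
  qed (use False in auto)
  then obtain t where t0: "if x + y < x then x + y < t \<and> t < x else x < t \<and> t < x + y"
    and t1: "(x + y) powr p = (\<Sum>m<2. ?d m x / fact m * (x + y - x) ^ m) + ?d 2 t / fact 2 * (x + y - x) ^ 2"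
    by blast
  have t: "0 < t" "t < 2 * x" using t0 x y by (auto split: if_splits)
  have eq: "(x + y) powr p = x powr p + p * x powr (p - 1) * y + p * (p - 1) * t powr (p - 2) / 2 * y\<^sup>2"
    using t1 by (simp add: numeral_2_eq_2)
  have "t powr (p - 2) \<le> (2 * x) powr (p - 2)"
    using t p by (intro powr_mono2) auto
  also have "\<dots> = 2 powr (p - 2) * x powr (p - 2)"
    using x by (simp add: powr_mult)
  also have "\<dots> \<le> 2 powr p * x powr (p - 2)"
    by (intro mult_right_mono powr_mono) auto
  finally have tp: "t powr (p - 2) \<le> 2 powr p * x powr (p - 2)" .
  have "p * (p - 1) * t powr (p - 2) / 2 \<le> p * p * (2 powr p * x powr (p - 2))"
  proof -
    have "p * (p - 1) * t powr (p - 2) / 2 \<le> p * (p - 1) * t powr (p - 2)"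
      using p by simp
    also have "\<dots> \<le> p * p * (2 powr p * x powr (p - 2))"
      using p tp by (intro mult_mono) auto
    finally show ?thesis .
  qed
  from mult_right_mono[OF this, of "y\<^sup>2"] show ?thesis
    unfolding eq by (simp add: power2_eq_square mult_ac)
qed simp

text \<open>
  The first-order term keeps its sign, because its expectation will vanish when \<open>x\<close> is replaced by
  a partial sum and \<open>y\<close> by the next martingale difference. If \<open>|y| < |x|\<close>, the sign of \<open>x\<close> can be
  normalised and Taylor's formula applies. Otherwise every term is bounded by a multiple of
  \<open>|y|\<^sup>p\<close>, which is why that summand appears on the right.
\<close>

lemma abs_add_powr_le:
  fixes x y p r :: real
  assumes p: "2 \<le> p" "p \<le> r"
  shows "\<bar>x + y\<bar> powr p \<le> \<bar>x\<bar> powr p + p * (sgn x * \<bar>x\<bar> powr (p - 1)) * y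
    + expansion_const r * (\<bar>x\<bar> powr (p - 2) * y\<^sup>2 + \<bar>y\<bar> powr p)"
proof (cases "\<bar>y\<bar> < \<bar>x\<bar>")
  case True
  define z where "z = sgn x * y"
  have x0: "x \<noteq> 0" using True by auto
  have z: "\<bar>z\<bar> < \<bar>x\<bar>" "z\<^sup>2 = y\<^sup>2"
    using True x0 by (auto simp: z_def abs_mult sgn_if power_mult_distrib)
  have "\<bar>x + y\<bar> = \<bar>x\<bar> + z"
    using True by (auto simp: z_def sgn_if abs_if split: if_splits)
  then have "\<bar>x + y\<bar> powr p \<le> \<bar>x\<bar> powr p + p * \<bar>x\<bar> powr (p - 1) * z
      + p\<^sup>2 * 2 powr p * (\<bar>x\<bar> powr (p - 2) * y\<^sup>2)"
    using powr_taylor_le[OF p(1) _ z(1)] x0 z(2) by simp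
  also have "p\<^sup>2 * 2 powr p * (\<bar>x\<bar> powr (p - 2) * y\<^sup>2)
      \<le> expansion_const r * (\<bar>x\<bar> powr (p - 2) * y\<^sup>2 + \<bar>y\<bar> powr p)"
    unfolding expansion_const_def using p
    by (intro mult_mono power_mono powr_mono) (auto intro!: mult_nonneg_nonneg add_nonneg_nonneg)
  finally show ?thesis by (simp add: z_def mult_ac)
next
  case False
  have "\<bar>x + y\<bar> powr p \<le> (2 * \<bar>y\<bar>) powr p"
    using False p by (intro powr_mono2) auto
  also have "\<dots> \<le> 2 powr r * \<bar>y\<bar> powr p"
    using p by (auto simp: powr_mult intro!: mult_right_mono powr_mono)
  finally have 1: "\<bar>x + y\<bar> powr p \<le> 2 powr r * \<bar>y\<bar> powr p" .
  have "\<bar>p * (sgn x * \<bar>x\<bar> powr (p - 1)) * y\<bar> \<le> p * (1 * \<bar>y\<bar> powr (p - 1)) * \<bar>y\<bar>"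
    unfolding abs_mult using False p
    by (intro mult_mono) (auto simp: abs_sgn_eq intro!: powr_mono2)
  also have "\<dots> = p * \<bar>y\<bar> powr p"
    by (cases "y = 0") (auto simp: powr_diff)
  also have "\<dots> \<le> r * \<bar>y\<bar> powr p"
    using p by (intro mult_right_mono) auto
  finally have 2: "- (r * \<bar>y\<bar> powr p) \<le> p * (sgn x * \<bar>x\<bar> powr (p - 1)) * y" by linarith
  have 3: "2 powr r + r \<le> expansion_const r"
  proof -
    have r: "2 \<le> r" and e: "1 \<le> 2 powr r" using p by (auto intro!: ge_one_powr_ge_zero)
    have "1 * 2 powr r \<le> r * 2 powr r" "r * 1 \<le> r * 2 powr r"
      using r e by (intro mult_right_mono mult_left_mono; simp)+
    then have "2 powr r + r \<le> r * 2 powr r + r * 2 powr r" by linarith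
    also have "\<dots> = (2 * r) * 2 powr r" by simp
    also have "\<dots> \<le> (r * r) * 2 powr r"
      using r by (intro mult_right_mono) auto
    finally show ?thesis by (simp add: expansion_const_def power2_eq_square)
  qed
  have "2 powr r * \<bar>y\<bar> powr p + r * \<bar>y\<bar> powr p \<le> expansion_const r * \<bar>y\<bar> powr p"
    using mult_right_mono[OF 3, of "\<bar>y\<bar> powr p"] by (simp add: algebra_simps)
  also have "\<dots> \<le> expansion_const r * (\<bar>x\<bar> powr (p - 2) * y\<^sup>2 + \<bar>y\<bar> powr p)"
    unfolding expansion_const_def by (intro mult_left_mono) auto
  finally show ?thesis using 1 2 powr_ge_zero[of "\<bar>x\<bar>" p] by linarith
qed

section \<open>One martingale step\<close>

text \<open>
  Hoelder's inequality before integration: if \<open>u\<close> and \<open>v\<close> are random with means at most \<open>A\<close> and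
  \<open>B\<close>, the right-hand side has mean at most \<open>A\<close> to the power \<open>1 - \<theta>\<close> times \<open>B\<close> to the power
  \<open>\<theta>\<close>. It is Young's inequality for the normalised quantities \<open>u / A\<close> and \<open>v / B\<close>.
\<close>

lemma powr_mult_powr_le:
  fixes u v A B \<theta> :: real
  assumes \<theta>: "0 < \<theta>" "\<theta> < 1" and "0 \<le> u" "0 \<le> v" "0 < A" "0 < B"
  shows "u powr (1 - \<theta>) * v powr \<theta>
    \<le> A powr (1 - \<theta>) * B powr \<theta> * ((1 - \<theta>) * (u / A) + \<theta> * (v / B))"
proof (cases "u = 0 \<or> v = 0")
  case True
  then show ?thesis using assms by auto
next
  case False
  then have "0 < u" "0 < v" using assms by auto
  have "(u / A) powr (1 - \<theta>) * (v / B) powr \<theta> \<le> (1 - \<theta>) * (u / A) + \<theta> * (v / B)"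
    using assms \<open>0 < u\<close> \<open>0 < v\<close> by (intro Youngs_inequality_0) auto
  then have "A powr (1 - \<theta>) * B powr \<theta> * ((u / A) powr (1 - \<theta>) * (v / B) powr \<theta>)
    \<le> A powr (1 - \<theta>) * B powr \<theta> * ((1 - \<theta>) * (u / A) + \<theta> * (v / B))"
    by (intro mult_left_mono) auto
  then show ?thesis using assms by (simp add: powr_divide)
qed

text \<open>
  This makes the first-order term of the expansion integrable, so that conditioning may be applied
  to it.
\<close>

lemma abs_mult_powr_le:
  fixes x y p :: real
  assumes p: "1 \<le> p"
  shows "\<bar>sgn x * \<bar>x\<bar> powr (p - 1) * y\<bar> \<le> \<bar>x\<bar> powr p + \<bar>y\<bar> powr p"
proof -
  let ?m = "max \<bar>x\<bar> \<bar>y\<bar>"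
  have "\<bar>sgn x * \<bar>x\<bar> powr (p - 1) * y\<bar> \<le> 1 * ?m powr (p - 1) * ?m"
    unfolding abs_mult using p by (intro mult_mono) (auto simp: abs_sgn_eq intro!: powr_mono2)
  also have "\<dots> = ?m powr p" by (cases "?m = 0") (auto simp: powr_diff)
  also have "\<dots> \<le> \<bar>x\<bar> powr p + \<bar>y\<bar> powr p" by (auto simp: max_def)
  finally show ?thesis .
qed

text \<open>
  Integrate the expansion at \<open>x = S\<close>, \<open>y = X\<close>. The linear term is \<open>X\<close> times a \<open>G\<close>-measurable
  variable, so its expectation is zero; the mixed term \<open>|S|\<^sup>p\<^sup>-\<^sup>2 X\<^sup>2\<close> is controlled by Hoelder's
  inequality with exponents \<open>p / (p - 2)\<close> and \<open>p / 2\<close>.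
\<close>

lemma moment_add_martingale_difference_le:
  fixes S X :: "'a \<Rightarrow> real"
  assumes "prob_space M" and sub: "subalgebra M G"
    and S_G: "S \<in> borel_measurable G" and X: "integrable M X"
    and ce: "AE \<omega> in M. real_cond_exp M G X \<omega> = 0"
    and p: "2 < p" "p \<le> r" and A: "0 < A" and B: "0 < B"
    and intS: "integrable M (\<lambda>\<omega>. \<bar>S \<omega>\<bar> powr p)" and leS: "(\<integral>\<omega>. \<bar>S \<omega>\<bar> powr p \<partial>M) \<le> A"
    and intX: "integrable M (\<lambda>\<omega>. \<bar>X \<omega>\<bar> powr p)" and leX: "(\<integral>\<omega>. \<bar>X \<omega>\<bar> powr p \<partial>M) \<le> B"
  shows "integrable M (\<lambda>\<omega>. \<bar>S \<omega> + X \<omega>\<bar> powr p)" (is ?int)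
    and "(\<integral>\<omega>. \<bar>S \<omega> + X \<omega>\<bar> powr p \<partial>M)
      \<le> A + expansion_const r * (A powr (1 - 2 / p) * B powr (2 / p) + B)" (is ?le)
proof -
  interpret prob_space M by fact
  interpret finite_measure_subalgebra M G using sub by unfold_locales
  let ?K = "expansion_const r"
  define g where "g = (\<lambda>\<omega>. sgn (S \<omega>) * \<bar>S \<omega>\<bar> powr (p - 1))"
  have K: "1 \<le> ?K" using expansion_const_ge_1 p by simp
  have S_M[measurable]: "S \<in> borel_measurable M"
    by (rule measurable_from_subalg[OF sub S_G])
  have X_M[measurable]: "X \<in> borel_measurable M" using X by auto
  have g_G: "g \<in> borel_measurable G" unfolding g_def using S_G by measurable
  have g_M[measurable]: "g \<in> borel_measurable M"
    by (rule measurable_from_subalg[OF sub g_G])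
  have int_gX: "integrable M (\<lambda>\<omega>. g \<omega> * X \<omega>)"
  proof (rule Bochner_Integration.integrable_bound)
    show "integrable M (\<lambda>\<omega>. \<bar>S \<omega>\<bar> powr p + \<bar>X \<omega>\<bar> powr p)"
      using intS intX by auto
    show "AE \<omega> in M. norm (g \<omega> * X \<omega>) \<le> norm (\<bar>S \<omega>\<bar> powr p + \<bar>X \<omega>\<bar> powr p)"
      using abs_mult_powr_le[of p] p unfolding g_def by (intro AE_I2) auto
  qed measurable
  have "(\<integral>\<omega>. g \<omega> * X \<omega> \<partial>M) = (\<integral>\<omega>. g \<omega> * real_cond_exp M G X \<omega> \<partial>M)"
    using real_cond_exp_intg(2)[OF int_gX g_G X_M] by simp
  also have "\<dots> = (\<integral>\<omega>. 0 \<partial>M)"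
    by (rule integral_cong_AE) (use ce in auto)
  finally have gX0: "(\<integral>\<omega>. g \<omega> * X \<omega> \<partial>M) = 0" by simp
  \<comment> \<open>an integrable majorant of the mixed term, from Young's inequality with \<open>\<theta> = 2 / p\<close>\<close>
  define H where "H = (\<lambda>\<omega>. A powr (1 - 2 / p) * B powr (2 / p)
      * ((1 - 2 / p) * (\<bar>S \<omega>\<bar> powr p / A) + 2 / p * (\<bar>X \<omega>\<bar> powr p / B)))"
  have int_H: "integrable M H" unfolding H_def using intS intX by auto
  have H_le: "(\<integral>\<omega>. H \<omega> \<partial>M) \<le> A powr (1 - 2 / p) * B powr (2 / p)"
  proof -
    have "(\<integral>\<omega>. H \<omega> \<partial>M) = A powr (1 - 2 / p) * B powr (2 / p) *
        ((1 - 2 / p) * ((\<integral>\<omega>. \<bar>S \<omega>\<bar> powr p \<partial>M) / A) + 2 / p * ((\<integral>\<omega>. \<bar>X \<omega>\<bar> powr p \<partial>M) / B))"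
      unfolding H_def using intS intX by simp
    also have "\<dots> \<le> A powr (1 - 2 / p) * B powr (2 / p) * ((1 - 2 / p) * 1 + 2 / p * 1)"
      using p A B leS leX by (intro mult_left_mono add_mono) auto
    finally show ?thesis by simp
  qed
  have H_ge: "\<bar>S \<omega>\<bar> powr (p - 2) * (X \<omega>)\<^sup>2 \<le> H \<omega>" for \<omega>
  proof -
    have "p * (1 - 2 / p) = p - 2" "p * (2 / p) = 2" using p by (auto simp: field_simps)
    then show ?thesis
      using powr_mult_powr_le[of "2 / p" "\<bar>S \<omega>\<bar> powr p" "\<bar>X \<omega>\<bar> powr p" A B] p A B
      unfolding H_def by (simp add: powr_powr)
  qed
  define R where "R = (\<lambda>\<omega>. \<bar>S \<omega>\<bar> powr p + p * (g \<omega> * X \<omega>) + ?K * (H \<omega> + \<bar>X \<omega>\<bar> powr p))"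
  have int_R: "integrable M R"
    unfolding R_def using intS intX int_gX int_H by auto
  have le_R: "\<bar>S \<omega> + X \<omega>\<bar> powr p \<le> R \<omega>" for \<omega>
  proof -
    have "?K * (\<bar>S \<omega>\<bar> powr (p - 2) * (X \<omega>)\<^sup>2 + \<bar>X \<omega>\<bar> powr p) \<le> ?K * (H \<omega> + \<bar>X \<omega>\<bar> powr p)"
      using H_ge K by (intro mult_left_mono add_right_mono) auto
    then show ?thesis
      using abs_add_powr_le[of p r "S \<omega>" "X \<omega>"] p unfolding R_def g_def
      by (simp add: mult.assoc)
  qed
  show int: ?int
  proof (rule Bochner_Integration.integrable_bound[OF int_R])
    show "AE \<omega> in M. norm (\<bar>S \<omega> + X \<omega>\<bar> powr p) \<le> norm (R \<omega>)"
      using le_R by (intro AE_I2) (auto intro: order_trans[OF _ abs_ge_self])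
  qed measurable
  have "(\<integral>\<omega>. \<bar>S \<omega> + X \<omega>\<bar> powr p \<partial>M) \<le> (\<integral>\<omega>. R \<omega> \<partial>M)"
    by (rule integral_mono[OF int int_R le_R])
  also have "\<dots> = (\<integral>\<omega>. \<bar>S \<omega>\<bar> powr p \<partial>M) + ?K * ((\<integral>\<omega>. H \<omega> \<partial>M) + (\<integral>\<omega>. \<bar>X \<omega>\<bar> powr p \<partial>M))"
    unfolding R_def using intS intX int_gX int_H by (simp add: gX0)
  also have "\<dots> \<le> A + ?K * (A powr (1 - 2 / p) * B powr (2 / p) + B)"
    using leS leX H_le K by (intro add_mono mult_left_mono) auto
  finally show ?le .
qed

section \<open>Moments of partial sums\<close>

text \<open>
  With \<open>D = 2 K\<close> the left-hand side is at most
  \<open>(D m)\<^sup>q + 2 K (D m)\<^sup>q\<^sup>-\<^sup>1 = D (m + 1) (D m)\<^sup>q\<^sup>-\<^sup>1\<close>: the factor 2 in \<open>D\<close> is what absorbs the additive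
  constant, because \<open>D m \<ge> 1\<close>.
\<close>

lemma growth_recursion_le:
  fixes m q K :: real
  assumes q: "1 \<le> q" and m: "1 \<le> m" and K: "1 \<le> K"
  shows "(2 * K * m) powr q + K * ((2 * K * m) powr (q - 1) + 1) \<le> (2 * K * (m + 1)) powr q"
proof -
  let ?D = "2 * K"
  have 1: "1 \<le> (?D * m) powr (q - 1)"
    using q m K mult_mono[of 1 ?D 1 m] by (intro ge_one_powr_ge_zero) auto
  have split: "(?D * m) powr q = ?D * m * (?D * m) powr (q - 1)"
    using m K by (simp add: powr_diff)
  have "(?D * m) powr q + K * ((?D * m) powr (q - 1) + 1)
      \<le> (?D * m) powr q + K * ((?D * m) powr (q - 1) + (?D * m) powr (q - 1))"
    using 1 K by (intro add_left_mono mult_left_mono) auto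
  also have "\<dots> = ?D * (m + 1) * (?D * m) powr (q - 1)"
    unfolding split by (simp add: algebra_simps)
  also have "\<dots> \<le> ?D * (m + 1) * (?D * (m + 1)) powr (q - 1)"
    using q m K by (intro mult_left_mono powr_mono2) auto
  also have "\<dots> = (?D * (m + 1)) powr q"
    using m K by (simp add: powr_diff)
  finally show ?thesis .
qed

text \<open>
  The moment inequality that carries the theorem: the \<open>p\<close>-th moment of a sum of \<open>n\<close> martingale
  differences grows at most like \<open>n\<close> to the power \<open>p / 2\<close>, with a constant that is uniform in
  \<open>p \<in> (2, r]\<close>. It is the one-step estimate iterated, the bound for \<open>n\<close> terms being fed back as \<open>A\<close>.
  The induction starts at one term because the step needs \<open>A > 0\<close>.
\<close>

lemma martingale_moment_le:
  fixes \<xi> :: "nat \<Rightarrow> 'a \<Rightarrow> real"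
  assumes "prob_space M" and md: "centered_martingale_differences M F \<xi>"
    and p: "2 < p" "p \<le> r" and b: "0 < b"
    and int: "\<And>i. 1 \<le> i \<Longrightarrow> integrable M (\<lambda>\<omega>. \<bar>\<xi> i \<omega>\<bar> powr p)"
    and le: "\<And>i. 1 \<le> i \<Longrightarrow> (\<integral>\<omega>. \<bar>\<xi> i \<omega>\<bar> powr p \<partial>M) \<le> b powr p"
    and n: "1 \<le> n"
  shows "integrable M (\<lambda>\<omega>. \<bar>\<Sum>k=1..n. \<xi> k \<omega>\<bar> powr p) \<and>
    (\<integral>\<omega>. \<bar>\<Sum>k=1..n. \<xi> k \<omega>\<bar> powr p \<partial>M) \<le> (2 * expansion_const r * real n) powr (p / 2) * b powr p"
  using n
proof (induction n rule: nat_induct_at_least)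
  case base
  have "1 \<le> (2 * expansion_const r) powr (p / 2)"
    using expansion_const_ge_1[of r] p by (intro ge_one_powr_ge_zero) auto
  from mult_right_mono[OF this, of "b powr p"] show ?case
    using int[of 1] le[of 1] by simp
next
  case (Suc n)
  let ?K = "expansion_const r" and ?S = "\<lambda>\<omega>. \<Sum>k=1..n. \<xi> k \<omega>"
  have K: "1 \<le> ?K" using expansion_const_ge_1 p by simp
  have fil: "filtration (space M) F" and sub: "\<And>i. subalgebra M (F i)"
    and meas: "\<And>i. 1 \<le> i \<Longrightarrow> \<xi> i \<in> borel_measurable (F i)"
    and intg: "\<And>i. 1 \<le> i \<Longrightarrow> integrable M (\<xi> i)"
    and ce: "\<And>k. 1 \<le> k \<Longrightarrow> AE \<omega> in M. real_cond_exp M (F (k - 1)) (\<xi> k) \<omega> = 0"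
    using md by (auto simp: centered_martingale_differences_def)
  have S_meas: "?S \<in> borel_measurable (F n)"
  proof (rule borel_measurable_sum)
    fix i assume "i \<in> {1..n}"
    then show "\<xi> i \<in> borel_measurable (F n)"
      using filtration.space_F[OF fil] filtration.sets_F_mono[OF fil, of i n]
      by (intro measurable_from_subalg[OF _ meas]) (auto simp: subalgebra_def)
  qed
  define A where "A = (2 * ?K * real n) powr (p / 2) * b powr p"
  have A: "0 < A" using Suc.hyps K b by (simp add: A_def)
  have "A powr (1 - 2 / p) * (b powr p) powr (2 / p)
      = (2 * ?K * real n) powr (p / 2 - 1) * b powr p"
  proof -
    have "p / 2 * (1 - 2 / p) = p / 2 - 1" "p * (1 - 2 / p) + p * (2 / p) = p"
      using p by (auto simp: field_simps)
    moreover have "A powr (1 - 2 / p) = (2 * ?K * real n) powr (p / 2 * (1 - 2 / p)) * b powr (p * (1 - 2 / p))"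
      unfolding A_def using K b by (subst powr_mult) (auto simp: powr_powr)
    ultimately show ?thesis by (simp add: powr_powr mult.assoc diff_divide_distrib flip: powr_add)
  qed
  then have eq: "A + ?K * (A powr (1 - 2 / p) * (b powr p) powr (2 / p) + b powr p)
      = ((2 * ?K * real n) powr (p / 2) + ?K * ((2 * ?K * real n) powr (p / 2 - 1) + 1)) * b powr p"
    by (simp add: A_def algebra_simps)
  also have "\<dots> \<le> (2 * ?K * (real n + 1)) powr (p / 2) * b powr p"
    using growth_recursion_le[of "p / 2" "real n" ?K] p K Suc.hyps by (intro mult_right_mono) auto
  finally have grow: "A + ?K * (A powr (1 - 2 / p) * (b powr p) powr (2 / p) + b powr p)
      \<le> (2 * ?K * real (Suc n)) powr (p / 2) * b powr p" by (simp add: add.commute)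
  have ceS: "AE \<omega> in M. real_cond_exp M (F n) (\<xi> (Suc n)) \<omega> = 0"
    using ce[of "Suc n"] by simp
  have bp: "0 < b powr p" using b by simp
  note step = moment_add_martingale_difference_le[OF \<open>prob_space M\<close> sub S_meas intg ceS p A bp
      conjunct1[OF Suc.IH] _ int le]
  show ?case
    using step order_trans[OF step(2) grow] Suc.IH by (simp add: A_def)
qed

section \<open>From norms to tails\<close>

lemma moment_le_of_moment_norm_le:
  assumes p: "0 < p" and b: "0 \<le> b" and [measurable]: "X \<in> borel_measurable M"
    and le: "moment_norm M p X \<le> ennreal b"
  shows "integrable M (\<lambda>\<omega>. \<bar>X \<omega>\<bar> powr p)" (is ?int)
    and "(\<integral>\<omega>. \<bar>X \<omega>\<bar> powr p \<partial>M) \<le> b powr p" (is ?le)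
proof -
  let ?I = "\<integral>\<^sup>+ \<omega>. ennreal (\<bar>X \<omega>\<bar> powr p) \<partial>M"
  have fin: "?I \<noteq> \<top>"
    using le by (auto simp: moment_norm_def epowr_def top_unique split: if_splits)
  show ?int
    using fin by (intro integrableI_nonneg) (auto simp: top.not_eq_extremum)
  have "enn2real ?I powr (1 / p) \<le> b"
    using le fin b by (simp add: moment_norm_def epowr_def)
  then have "(enn2real ?I powr (1 / p)) powr p \<le> b powr p"
    using p by (intro powr_mono2) auto
  then show ?le
    using p by (simp add: powr_powr integral_eq_nn_integral)
qed

lemma moment_norm_le_of_G_norm_le:
  assumes "G_norm M \<nu> r X \<le> ennreal K" and p: "2 < p" "p < r"
    and v: "\<nu> p = ennreal v" "0 < v" and K: "0 \<le> K"
  shows "moment_norm M p X \<le> ennreal (K * v)"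
proof -
  have "moment_norm M p X / \<nu> p \<le> G_norm M \<nu> r X"
    unfolding G_norm_def using p by (intro SUP_upper) auto
  then have le: "moment_norm M p X / ennreal v \<le> ennreal K"
    using assms(1) v(1) order_trans by simp
  have "moment_norm M p X = ennreal v * (moment_norm M p X / ennreal v)"
    using v by (simp add: ennreal_times_divide mult.commute[of "ennreal v"] ennreal_mult_divide_eq)
  also have "\<dots> \<le> ennreal v * ennreal K"
    by (rule mult_left_mono[OF le]) auto
  also have "\<dots> = ennreal (K * v)"
    using v K by (simp add: ennreal_mult' mult.commute)
  finally show ?thesis .
qed

text \<open>
  The norms can be read off from the law of the sequence; this is how the constant of the theorem
  becomes a function of that law.
\<close>

lemma G_norm_seq_law:
  assumes meas: "\<And>i. 1 \<le> i \<Longrightarrow> \<xi> i \<in> borel_measurable M" and i: "1 \<le> i"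
  shows "G_norm (seq_law M \<xi>) \<nu> r (\<lambda>w. w i) = G_norm M \<nu> r (\<xi> i)"
proof -
  have m: "(\<lambda>\<omega>. \<lambda>i\<in>{1..}. \<xi> i \<omega>) \<in> M \<rightarrow>\<^sub>M PiM {1..} (\<lambda>_. borel)"
    using meas by (intro measurable_restrict) auto
  have "(\<integral>\<^sup>+ w. ennreal (\<bar>w i\<bar> powr p) \<partial>seq_law M \<xi>) = (\<integral>\<^sup>+ \<omega>. ennreal (\<bar>\<xi> i \<omega>\<bar> powr p) \<partial>M)" for p
    unfolding seq_law_def using i by (subst nn_integral_distr[OF m]) (auto intro!: measurable_compose[OF measurable_component_singleton])
  then show ?thesis by (simp add: G_norm_def moment_norm_def)
qed

text \<open>
  Markov's inequality for \<open>|S|\<^sup>p\<close>; the normalisation by \<open>\<surd>n\<close> cancels the growth of the moment.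
\<close>

lemma normalized_tail_le:
  assumes p: "0 < p" and x: "0 < x" and n: "1 \<le> n" and D: "0 \<le> D"
    and int: "integrable M (\<lambda>\<omega>. \<bar>S \<omega>\<bar> powr p)"
    and le: "(\<integral>\<omega>. \<bar>S \<omega>\<bar> powr p \<partial>M) \<le> (D * real n) powr (p / 2) * b powr p"
  shows "emeasure M {\<omega> \<in> space M. \<bar>real n powr (- 1 / 2) * S \<omega>\<bar> \<ge> x}
    \<le> ennreal (D powr (p / 2) * b powr p / x powr p)"
proof -
  let ?c = "real n powr (p / 2) * x powr p"
  have "{\<omega> \<in> space M. \<bar>real n powr (- 1 / 2) * S \<omega>\<bar> \<ge> x} = {\<omega> \<in> space M. \<bar>S \<omega>\<bar> powr p \<ge> ?c}"
  proof (intro Collect_cong conj_cong refl)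
    fix \<omega>
    have "x \<le> \<bar>real n powr (- 1 / 2) * S \<omega>\<bar> \<longleftrightarrow> real n powr (1 / 2) * x \<le> \<bar>S \<omega>\<bar>"
      using n by (simp add: abs_mult powr_minus field_simps)
    also have "\<dots> \<longleftrightarrow> (real n powr (1 / 2) * x) powr p \<le> \<bar>S \<omega>\<bar> powr p"
      using p x powr_less_mono2[of p "\<bar>S \<omega>\<bar>" "real n powr (1 / 2) * x"]
        powr_mono2[of p "real n powr (1 / 2) * x" "\<bar>S \<omega>\<bar>"]
      by (metis abs_ge_zero less_imp_le linorder_not_less mult_nonneg_nonneg powr_ge_zero)
    also have "(real n powr (1 / 2) * x) powr p = ?c"
      using x by (simp add: powr_mult powr_powr)
    finally show "x \<le> \<bar>real n powr (- 1 / 2) * S \<omega>\<bar> \<longleftrightarrow> ?c \<le> \<bar>S \<omega>\<bar> powr p" .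
  qed
  also have "emeasure M \<dots> \<le> ennreal ((1 / ?c) * (\<integral>\<omega>. \<bar>S \<omega>\<bar> powr p \<partial>M))"
    using n x by (intro integral_Markov_inequality int) auto
  also have "\<dots> \<le> ennreal ((1 / ?c) * ((D * real n) powr (p / 2) * b powr p))"
    using le by (intro ennreal_leI mult_left_mono) auto
  also have "(1 / ?c) * ((D * real n) powr (p / 2) * b powr p) = D powr (p / 2) * b powr p / x powr p"
    using n D by (simp add: powr_mult)
  finally show ?thesis .
qed

lemma U_le_of_moment_norm_le:
  assumes "prob_space M" and md: "centered_martingale_differences M F \<xi>"
    and p: "2 < p" "p \<le> r" and b: "0 < b" and x: "0 < x"
    and le: "\<And>i. 1 \<le> i \<Longrightarrow> moment_norm M p (\<xi> i) \<le> ennreal b"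
  shows "U M \<xi> x \<le> ennreal ((2 * expansion_const r) powr (p / 2) * b powr p / x powr p)"
  unfolding U_def
proof (rule SUP_least)
  fix n :: nat assume "n \<in> {1..}"
  then have n: "1 \<le> n" by simp
  have meas: "\<And>i. 1 \<le> i \<Longrightarrow> \<xi> i \<in> borel_measurable M"
    using md by (auto simp: centered_martingale_differences_def)
  have "integrable M (\<lambda>\<omega>. \<bar>\<xi> i \<omega>\<bar> powr p)" "(\<integral>\<omega>. \<bar>\<xi> i \<omega>\<bar> powr p \<partial>M) \<le> b powr p"
    if "1 \<le> i" for i
    using moment_le_of_moment_norm_le[OF _ _ meas le, of i] that p b by auto
  note martingale_moment_le[OF assms(1,2) p b this n]
  then show "emeasure M {\<omega> \<in> space M. \<bar>real n powr (- 1 / 2) * (\<Sum>k=1..n. \<xi> k \<omega>)\<bar> \<ge> x}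
      \<le> ennreal ((2 * expansion_const r) powr (p / 2) * b powr p / x powr p)"
    using p x n expansion_const_ge_1[of r] by (intro normalized_tail_le) auto
qed

section \<open>Comparison with the tail function\<close>

text \<open>
  The norm of \<open>G(\<nu>; r)\<close> does not involve \<open>\<nu> p\<close> for \<open>p \<le> 2\<close>; all that is needed there is that
  \<open>\<nu>\<close>, being continuous and positive on the compact interval \<open>[1, 2]\<close>, is bounded away from zero.
\<close>

lemma admissible_powr_lower_bound:
  assumes r: "2 < r" and adm: "admissible r \<nu>"
  obtains m where "0 < m" "\<And>p. 1 \<le> p \<Longrightarrow> p \<le> 2 \<Longrightarrow> m \<le> enn2real (\<nu> p) powr p"
proof -
  have "continuous_on {1..2} \<nu>"
    using adm r by (auto simp: admissible_def intro: continuous_on_subset)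
  then obtain s where s: "s \<in> {1..2}" "\<And>p. p \<in> {1..2} \<Longrightarrow> \<nu> s \<le> \<nu> p"
    using continuous_attains_inf[of "{1..2::real}" \<nu>] by auto
  have fin: "0 < \<nu> p" "\<nu> p < \<top>" if "p \<in> {1..2}" for p
    using adm r that by (auto simp: admissible_def)
  define c where "c = min 1 (enn2real (\<nu> s))"
  have c: "0 < c" "c \<le> 1" using fin[OF s(1)] by (auto simp: c_def enn2real_positive_iff)
  show ?thesis
  proof (rule that[of "c powr 2"])
    fix p :: real assume p: "1 \<le> p" "p \<le> 2"
    have "c powr 2 \<le> c powr p" using c p by (intro powr_mono') auto
    also have "\<dots> \<le> enn2real (\<nu> p) powr p"
    proof (intro powr_mono2)
      have "enn2real (\<nu> s) \<le> enn2real (\<nu> p)"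
        using s(2)[of p] fin[of p] p by (intro enn2real_mono) auto
      then show "c \<le> enn2real (\<nu> p)" by (simp add: c_def)
    qed (use c p in auto)
    finally show "c powr 2 \<le> enn2real (\<nu> p) powr p" .
  qed (use c in auto)
qed

lemma le_mult_T:
  assumes adm: "admissible r \<nu>" and x: "0 < x" and C: "0 < C"
    and le: "\<And>p. 1 < p \<Longrightarrow> p < r \<Longrightarrow> u \<le> ennreal (C * (enn2real (\<nu> p) powr p / x powr p))"
  shows "u \<le> ennreal C * T \<nu> r x"
proof -
  have "u / ennreal C \<le> T \<nu> r x"
    unfolding T_def
  proof (rule INF_greatest)
    fix p assume "p \<in> {1<..<r}"
    then have p: "1 < p" "p < r" by auto
    have "\<nu> p < \<top>" using adm p by (auto simp: admissible_def)
    then have "epowr (\<nu> p) p / ennreal (x powr p) = ennreal (enn2real (\<nu> p) powr p / x powr p)"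
      using x by (simp add: epowr_def divide_ennreal)
    moreover have "u / ennreal C \<le> ennreal (enn2real (\<nu> p) powr p / x powr p)"
      using le[OF p] C by (intro divide_le_posI_ennreal) (auto simp flip: ennreal_mult')
    ultimately show "u / ennreal C \<le> epowr (\<nu> p) p / ennreal (x powr p)" by simp
  qed
  then have "ennreal C * (u / ennreal C) \<le> ennreal C * T \<nu> r x"
    by (rule mult_left_mono) auto
  then show ?thesis
    using C by (simp add: ennreal_times_divide mult.commute[of "ennreal C"] ennreal_mult_divide_eq)
qed

theorem theorem5p2:
  fixes r :: real and \<nu> :: "real \<Rightarrow> ennreal"
  assumes "2 < r" and "admissible r \<nu>"
  shows "\<exists>C :: (nat \<Rightarrow> real) measure \<Rightarrow> real.
    \<forall>(M :: 'a measure) F \<xi>.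
      prob_space M \<longrightarrow>
      centered_martingale_differences M F \<xi> \<longrightarrow>
      (SUP i\<in>{1..}. G_norm M \<nu> r (\<xi> i)) < \<top> \<longrightarrow>
      (\<forall>x>0. U M \<xi> x \<le> ennreal (C (seq_law M \<xi>)) * T \<nu> r x)"
proof -
  obtain m where m: "0 < m" "\<And>p. 1 \<le> p \<Longrightarrow> p \<le> 2 \<Longrightarrow> m \<le> enn2real (\<nu> p) powr p"
    using admissible_powr_lower_bound[OF assms] by blast
  \<comment> \<open>any fixed exponent in \<open>(2, r)\<close>; its moments serve for all \<open>p \<le> 2\<close>\<close>
  define s where "s = (2 + r) / 2"
  have s: "2 < s" "s < r" using assms(1) by (auto simp: s_def)
  define D where "D = 2 * expansion_const r"
  have D: "1 \<le> D" using expansion_const_ge_1[of r] assms(1) by (simp add: D_def)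
  \<comment> \<open>at least 1, so that its powers increase with the exponent\<close>
  define K :: "(nat \<Rightarrow> real) measure \<Rightarrow> real"
    where "K = (\<lambda>L. max 1 (enn2real (SUP i\<in>{1..}. G_norm L \<nu> r (\<lambda>w. w i))))"
  define B where "B = (\<lambda>L. D powr (s / 2) * (K L * enn2real (\<nu> s)) powr s)"
  \<comment> \<open>the first summand handles \<open>p > 2\<close>, the second \<open>p \<le> 2\<close>\<close>
  define C where "C = (\<lambda>L. D powr r * K L powr r + max 1 (B L) / m)"
  have "U M \<xi> x \<le> ennreal (C (seq_law M \<xi>)) * T \<nu> r x"
    if M: "prob_space M" and md: "centered_martingale_differences M F \<xi>"
      and fin: "(SUP i\<in>{1..}. G_norm M \<nu> r (\<xi> i)) < \<top>" and x: "0 < x"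
    for M :: "'a measure" and F \<xi> x
  proof -
    interpret prob_space M by fact
    define L where "L = seq_law M \<xi>"
    have meas: "\<And>i. 1 \<le> i \<Longrightarrow> \<xi> i \<in> borel_measurable M"
      using md by (auto simp: centered_martingale_differences_def)
    have K1: "1 \<le> K L" by (simp add: K_def)
    have G_le: "G_norm M \<nu> r (\<xi> i) \<le> ennreal (K L)" if i: "1 \<le> i" for i
    proof -
      have eq: "(SUP i\<in>{1..}. G_norm L \<nu> r (\<lambda>w. w i)) = (SUP i\<in>{1..}. G_norm M \<nu> r (\<xi> i))"
        unfolding L_def using G_norm_seq_law[of \<xi> M] meas by (intro SUP_cong) auto
      have "G_norm M \<nu> r (\<xi> i) \<le> (SUP i\<in>{1..}. G_norm M \<nu> r (\<xi> i))"
        using i by (intro SUP_upper) auto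
      also have "\<dots> = ennreal (enn2real (SUP i\<in>{1..}. G_norm M \<nu> r (\<xi> i)))"
        using fin by simp
      also have "\<dots> \<le> ennreal (K L)"
        unfolding K_def eq by (intro ennreal_leI) auto
      finally show ?thesis .
    qed
    have U_le: "U M \<xi> x \<le> ennreal (D powr (p / 2) * (K L * enn2real (\<nu> p)) powr p / x powr p)"
      if p: "2 < p" "p < r" for p
    proof -
      have v: "\<nu> p = ennreal (enn2real (\<nu> p))" "0 < enn2real (\<nu> p)"
        using assms(2) p by (auto simp: admissible_def enn2real_positive_iff)
      show ?thesis
        unfolding D_def using p x K1 v(2)
        by (intro U_le_of_moment_norm_le[OF M md] moment_norm_le_of_G_norm_le[OF G_le _ _ v]) auto
    qed
    have C_pos: "0 < C L" using D K1 m(1) by (auto simp: C_def intro!: add_pos_pos divide_pos_pos)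
    have "U M \<xi> x \<le> ennreal (C L * (enn2real (\<nu> p) powr p / x powr p))"
      if p: "1 < p" "p < r" for p
    proof (cases "2 < p")
      case True
      have "D powr (p / 2) * K L powr p \<le> D powr r * K L powr r"
        using D K1 p by (intro mult_mono powr_mono) auto
      also have "\<dots> \<le> C L" using m(1) by (simp add: C_def)
      finally have "D powr (p / 2) * K L powr p * (enn2real (\<nu> p) powr p / x powr p)
          \<le> C L * (enn2real (\<nu> p) powr p / x powr p)"
        by (intro mult_right_mono) auto
      then show ?thesis
        using U_le[OF True p(2)] K1
        by (auto simp: powr_mult mult.assoc intro: order_trans ennreal_leI)
    next
      case False
      \<comment> \<open>below \<open>x = 1\<close> the trivial bound suffices; above it the power \<open>s > p\<close> of \<open>x\<close> is the larger one\<close>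
      have U1: "U M \<xi> x \<le> ennreal 1"
        unfolding U_def by (auto intro!: SUP_least emeasure_le_1)
      have "U M \<xi> x \<le> ennreal (max 1 (B L) / x powr p)"
      proof (cases "x \<le> 1")
        case True
        have "x powr p \<le> 1" using True x p by (simp add: powr_le1)
        then have "1 \<le> max 1 (B L) / x powr p"
          using x by (simp add: le_divide_eq le_max_iff_disj)
        with U1 show ?thesis by (blast intro: order_trans ennreal_leI)
      next
        case x1: False
        have "B L / x powr s \<le> max 1 (B L) / x powr p"
          using x1 False s by (intro frac_le powr_mono) auto
        then show ?thesis
          using U_le[OF s] unfolding B_def by (blast intro: order_trans ennreal_leI)
      qed
      also have "max 1 (B L) / x powr p \<le> C L * (enn2real (\<nu> p) powr p / x powr p)"
      proof -
        have "max 1 (B L) = max 1 (B L) / m * m" using m(1) by simp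
        also have "\<dots> \<le> C L * enn2real (\<nu> p) powr p"
          using m False p C_pos by (intro mult_mono) (auto simp: C_def)
        finally show ?thesis using x by (simp add: divide_right_mono)
      qed
      finally show ?thesis by (simp add: ennreal_leI)
    qed
    from le_mult_T[OF assms(2) x C_pos this] show ?thesis by (simp add: L_def)
  qed
  then show ?thesis by (intro exI[of _ C]) blast
qed

end
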